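(* Let $v$ be any vertex of an acyclic quiver $Q$, and let $Q_1,Q_2\in[Q]_v$, i.e. $Q_1,Q_2$ are acyclic quivers in the flip-equivalence class $[Q]$ in both of which $v$ is a source. Then there exists a sequence of source-sink flips from $Q_1$ to $Q_2$ such that every intermediate quiver in the sequence also has $v$ as a source. In other words, the flip sequence does not flip at $v$, nor at neighbors of $v$.
   Context: All quivers are finite directed graphs that are simple (no loops, no parallel or anti-parallel arcs) and acyclic (no directed cycles). A source is a vertex all of whose incident arcs point away from it; a sink is a vertex all of whose incident arcs point into it (an isolated vertex is both). A flip at a source or sink $k$ reverses all arcs incident to $k$ (turning a source into a sink or a sink into a source). Two acyclic quivers are equivalent if they are related by a finite sequence of flips; $[Q]$ denotes the equivalence class of $Q$, and $[Q]_v$ denotes the set of quivers in $[Q]$ in which $v$ is a source. *)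

theory Defs
  imports "Graph_Theory.Pair_Digraph"
begin

text \<open>
  A quiver is a \<open>pair_digraph\<close>: finite, without loops, and without parallel arcs because arcs are
  ordered pairs. The condition \<open>asym\<close> excludes anti-parallel arcs; it is implied by \<open>acyclic\<close>, but
  kept to match the definition of a simple quiver.
\<close>

definition acyclic_quiver :: "'a pair_pre_digraph \<Rightarrow> bool" where
  "acyclic_quiver Q \<longleftrightarrow> pair_digraph Q \<and> asym (parcs Q) \<and> acyclic (parcs Q)"

definition is_source :: "'a pair_pre_digraph \<Rightarrow> 'a \<Rightarrow> bool" where
  "is_source Q k \<longleftrightarrow> k \<in> pverts Q \<and> (\<forall>(a, b) \<in> parcs Q. k = a \<or> k = b \<longrightarrow> a = k)"

definition is_sink :: "'a pair_pre_digraph \<Rightarrow> 'a \<Rightarrow> bool" where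
  "is_sink Q k \<longleftrightarrow> k \<in> pverts Q \<and> (\<forall>(a, b) \<in> parcs Q. k = a \<or> k = b \<longrightarrow> b = k)"

definition neighbors :: "'a pair_pre_digraph \<Rightarrow> 'a \<Rightarrow> 'a set" where
  "neighbors Q v = {w. (v, w) \<in> parcs Q \<or> (w, v) \<in> parcs Q}"

definition flip :: "'a \<Rightarrow> 'a pair_pre_digraph \<Rightarrow> 'a pair_pre_digraph" where
  "flip k Q = Q\<lparr>parcs := (\<lambda>(a, b). if k = a \<or> k = b then (b, a) else (a, b)) ` parcs Q\<rparr>"

text \<open>
  The quivers \<open>P 0, \<dots>, P n\<close> are obtained by successively flipping at \<open>k 0, \<dots>, k (n - 1)\<close>; the
  values of \<open>P\<close> beyond \<open>n\<close> and of \<open>k\<close> from \<open>n\<close> on are irrelevant.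
\<close>

definition flip_sequence ::
    "nat \<Rightarrow> (nat \<Rightarrow> 'a pair_pre_digraph) \<Rightarrow> (nat \<Rightarrow> 'a) \<Rightarrow> 'a pair_pre_digraph \<Rightarrow> 'a pair_pre_digraph \<Rightarrow> bool"
  where
  "flip_sequence n P k Q Q' \<longleftrightarrow>
     P 0 = Q \<and> P n = Q' \<and>
     (\<forall>i<n. (is_source (P i) (k i) \<or> is_sink (P i) (k i)) \<and> P (Suc i) = flip (k i) (P i))"

definition flip_equivalent :: "'a pair_pre_digraph \<Rightarrow> 'a pair_pre_digraph \<Rightarrow> bool" where
  "flip_equivalent Q Q' \<longleftrightarrow> (\<exists>n P k. flip_sequence n P k Q Q')"

definition flip_class :: "'a pair_pre_digraph \<Rightarrow> 'a pair_pre_digraph set" where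
  "flip_class Q = {Q'. acyclic_quiver Q' \<and> flip_equivalent Q Q'}"

definition flip_class_source :: "'a pair_pre_digraph \<Rightarrow> 'a \<Rightarrow> 'a pair_pre_digraph set" where
  "flip_class_source Q v = {Q' \<in> flip_class Q. is_source Q' v}"

end

theory Submission
  imports Defs
begin

text \<open>
  A flip sequence from \<open>Q\<close> to \<open>Q'\<close> is recorded, up to order, by an integer potential \<open>h\<close>, where
  \<open>h k\<close> is the number of flips of \<open>k\<close> as a source minus the number of flips of \<open>k\<close> as a sink: an arc
  \<open>a \<rightarrow> b\<close> is kept if \<open>h a = h b\<close> and reversed if \<open>h a = h b + 1\<close>, and nothing else can occur.
  Only differences of \<open>h\<close> matter, so one may assume \<open>h v = 0\<close>; if \<open>v\<close> is a source at both ends, then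
  \<open>h\<close> also vanishes at the neighbors of \<open>v\<close>. Conversely, a potential can be realised by flipping
  only vertices of its support. If its maximum is positive, every arc between the maximum set and
  its complement leaves the maximum set, so by acyclicity that set contains a source of the whole
  quiver, and flipping it decreases \<open>\<Sum> \<bar>h\<bar>\<close>. A negative minimum is treated dually.
\<close>

definition flip_potential ::
    "('a \<Rightarrow> int) \<Rightarrow> 'a pair_pre_digraph \<Rightarrow> 'a pair_pre_digraph \<Rightarrow> bool" where
  "flip_potential h Q Q' \<longleftrightarrow> pverts Q' = pverts Q \<and>
     (\<forall>a b. (a, b) \<in> parcs Q \<longrightarrow>
        (a, b) \<in> parcs Q' \<and> h a = h b \<or> (b, a) \<in> parcs Q' \<and> h a = h b + 1) \<and>
     (\<forall>a b. (a, b) \<in> parcs Q' \<longrightarrow>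
        (a, b) \<in> parcs Q \<and> h a = h b \<or> (b, a) \<in> parcs Q \<and> h b = h a + 1)"

section \<open>Composition, inversion and normalisation of potentials\<close>

lemma flip_potential_refl: "flip_potential (\<lambda>_. 0) Q Q"
  by (simp add: flip_potential_def)

lemma flip_potential_sym:
  assumes "flip_potential h Q Q'"
  shows "flip_potential (\<lambda>a. - h a) Q' Q"
  using assms unfolding flip_potential_def by fastforce

lemma flip_potential_trans:
  assumes "flip_potential h Q Q'" and "flip_potential g Q' Q''"
  shows "flip_potential (\<lambda>a. h a + g a) Q Q''"
  unfolding flip_potential_def
proof (intro conjI allI impI)
  show "pverts Q'' = pverts Q"
    using assms by (simp add: flip_potential_def)
next
  fix a b
  assume "(a, b) \<in> parcs Q"
  with assms(1) have "(a, b) \<in> parcs Q' \<and> h a = h b \<or> (b, a) \<in> parcs Q' \<and> h a = h b + 1"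
    by (simp add: flip_potential_def)
  moreover have "(x, y) \<in> parcs Q'' \<and> g x = g y \<or> (y, x) \<in> parcs Q'' \<and> g x = g y + 1"
    if "(x, y) \<in> parcs Q'" for x y
    using assms(2) that by (simp add: flip_potential_def)
  ultimately show "(a, b) \<in> parcs Q'' \<and> h a + g a = h b + g b \<or>
      (b, a) \<in> parcs Q'' \<and> h a + g a = h b + g b + 1"
    by fastforce
next
  fix a b
  assume "(a, b) \<in> parcs Q''"
  with assms(2) have "(a, b) \<in> parcs Q' \<and> g a = g b \<or> (b, a) \<in> parcs Q' \<and> g b = g a + 1"
    by (simp add: flip_potential_def)
  moreover have "(x, y) \<in> parcs Q \<and> h x = h y \<or> (y, x) \<in> parcs Q \<and> h y = h x + 1"
    if "(x, y) \<in> parcs Q'" for x y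
    using assms(1) that by (simp add: flip_potential_def)
  ultimately show "(a, b) \<in> parcs Q \<and> h a + g a = h b + g b \<or>
      (b, a) \<in> parcs Q \<and> h b + g b = h a + g a + 1"
    by fastforce
qed

lemma flip_potential_shift:
  assumes "flip_potential h Q Q'"
  shows "flip_potential (\<lambda>a. h a - c) Q Q'"
  using assms unfolding flip_potential_def by auto

lemma flip_potential_zero:
  assumes "flip_potential h Q Q'" and "pair_wf_digraph Q" and "\<forall>a\<in>pverts Q. h a = 0"
  shows "Q' = Q"
proof -
  have "parcs Q \<subseteq> pverts Q \<times> pverts Q"
    using assms(2) by (auto simp: pair_wf_digraph_def)
  with assms have "parcs Q' = parcs Q"
    unfolding flip_potential_def by fastforce
  with assms(1) show ?thesis
    by (simp add: flip_potential_def)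
qed

section \<open>Single flips and their potentials\<close>

lemma pverts_flip [simp]: "pverts (flip k Q) = pverts Q"
  by (simp add: flip_def)

lemma mem_parcs_flip [simp]:
  "(a, b) \<in> parcs (flip k Q) \<longleftrightarrow>
     (if k = a \<or> k = b then (b, a) \<in> parcs Q else (a, b) \<in> parcs Q)"
  by (auto simp: flip_def image_iff split: if_splits) (auto intro!: bexI)

lemma neighbors_flip [simp]: "neighbors (flip k Q) v = neighbors Q v"
  by (auto simp: neighbors_def)

lemma neighbors_flip_potential:
  assumes "flip_potential h Q Q'"
  shows "neighbors Q' v = neighbors Q v"
  using assms unfolding flip_potential_def neighbors_def by blast

lemma is_source_iff:
  "is_source Q k \<longleftrightarrow> k \<in> pverts Q \<and> (\<forall>a. (a, k) \<in> parcs Q \<longrightarrow> a = k)"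
  by (auto simp: is_source_def)

lemma is_sink_iff:
  "is_sink Q k \<longleftrightarrow> k \<in> pverts Q \<and> (\<forall>b. (k, b) \<in> parcs Q \<longrightarrow> b = k)"
  by (auto simp: is_sink_def)

lemma is_source_flip:
  assumes "is_source Q v" and "k \<noteq> v" and "k \<notin> neighbors Q v"
  shows "is_source (flip k Q) v"
  using assms by (auto simp: is_source_iff neighbors_def)

lemma flip_potential_flip_source:
  assumes "is_source Q k"
  shows "flip_potential (\<lambda>a. if a = k then 1 else 0) Q (flip k Q)"
  using assms by (auto simp: flip_potential_def is_source_iff)

lemma flip_potential_flip_sink:
  assumes "is_sink Q k"
  shows "flip_potential (\<lambda>a. if a = k then - 1 else 0) Q (flip k Q)"
  using assms by (auto simp: flip_potential_def is_sink_iff)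

text \<open>The potentials of the single flips, plus or minus an indicator function, add up along
  the sequence.\<close>

lemma flip_equivalent_imp_potential:
  assumes "flip_equivalent Q Q'"
  obtains h where "flip_potential h Q Q'"
proof -
  obtain n P k where seq: "flip_sequence n P k Q Q'"
    using assms by (auto simp: flip_equivalent_def)
  have "\<exists>h. flip_potential h Q (P i)" if "i \<le> n" for i
    using that
  proof (induction i)
    case 0
    have "P 0 = Q"
      using seq by (simp add: flip_sequence_def)
    then show ?case
      using flip_potential_refl by metis
  next
    case (Suc i)
    then obtain h where h: "flip_potential h Q (P i)"
      by auto
    have "is_source (P i) (k i) \<or> is_sink (P i) (k i)" and "P (Suc i) = flip (k i) (P i)"
      using seq Suc.prems by (simp_all add: flip_sequence_def)
    then obtain g where "flip_potential g (P i) (P (Suc i))"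
      using flip_potential_flip_source flip_potential_flip_sink by metis
    with h show ?case
      using flip_potential_trans by blast
  qed
  moreover have "P n = Q'"
    using seq by (simp add: flip_sequence_def)
  ultimately show thesis
    using that by blast
qed

section \<open>Preservation of acyclicity\<close>

lemma acyclic_flip_source:
  assumes "acyclic (parcs Q)" and "is_source Q k"
  shows "acyclic (parcs (flip k Q))"
proof -
  have no_loop: "(k, k) \<notin> parcs Q"
    using assms(1) by (auto simp: acyclic_def)
  \<comment> \<open>After the flip \<open>k\<close> is a sink, so a path can meet \<open>k\<close>
    only at its end; all its other arcs avoid \<open>k\<close> and hence are arcs of
    \<open>Q\<close>. In particular a cycle would already lie in \<open>Q\<close>.\<close>
  have path: "x \<noteq> k \<and> (y \<noteq> k \<longrightarrow> (x, y) \<in> (parcs Q)\<^sup>+)" if "(x, y) \<in> (parcs (flip k Q))\<^sup>+" for x y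
    using that
  proof induction
    case (base y)
    then show ?case
      using assms(2) no_loop by (auto simp: is_source_iff split: if_splits)
  next
    case (step y z)
    then have "y \<noteq> k"
      using assms(2) no_loop by (auto simp: is_source_iff split: if_splits)
    with step show ?case
      by (auto split: if_splits intro: trancl_into_trancl)
  qed
  show ?thesis
    unfolding acyclic_def using path assms(1) by (auto simp: acyclic_def)
qed

lemma acyclic_flip_sink:
  assumes "acyclic (parcs Q)" and "is_sink Q k"
  shows "acyclic (parcs (flip k Q))"
proof -
  \<comment> \<open>Reversing all arcs exchanges sources and sinks, commutes with flips and
    preserves acyclicity, which reduces the claim to the source case.\<close>
  define Q' where "Q' = Q\<lparr>parcs := (parcs Q)\<inverse>\<rparr>"
  have "acyclic (parcs Q')" and "is_source Q' k"
    using assms by (auto simp: Q'_def acyclic_converse is_source_iff is_sink_iff)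
  then have "acyclic (parcs (flip k Q'))"
    by (rule acyclic_flip_source)
  moreover have "parcs (flip k Q') = (parcs (flip k Q))\<inverse>"
    by (auto simp: Q'_def split: if_splits)
  ultimately show ?thesis
    by (simp add: acyclic_converse)
qed

lemma acyclic_quiver_flip:
  assumes "acyclic_quiver Q" and "is_source Q k \<or> is_sink Q k"
  shows "acyclic_quiver (flip k Q)"
proof -
  interpret pair_digraph Q
    using assms(1) by (simp add: acyclic_quiver_def)
  have "acyclic (parcs (flip k Q))"
    using assms acyclic_flip_source acyclic_flip_sink by (auto simp: acyclic_quiver_def)
  moreover have "asym (parcs (flip k Q))"
    using assms(1) by (auto simp: acyclic_quiver_def asym_iff)
  moreover have "pair_digraph (flip k Q)"
  proof
    show "finite (pverts (flip k Q))"
      by simp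
    show "finite (parcs (flip k Q))"
      by (simp add: flip_def)
    fix e
    assume "e \<in> parcs (flip k Q)"
    then show "fst e \<in> pverts (flip k Q)" "snd e \<in> pverts (flip k Q)" "fst e \<noteq> snd e"
      using in_arcsD1 in_arcsD2 no_loops by (cases e; auto split: if_splits)+
  qed
  ultimately show ?thesis
    by (simp add: acyclic_quiver_def)
qed

section \<open>Sources and sinks where a potential is extremal\<close>

lemma exists_source_at_max:
  assumes "acyclic_quiver Q" and "flip_potential h Q Q'" and "c \<in> pverts Q"
  obtains k where "is_source Q k" and "h c \<le> h k"
proof -
  interpret pair_digraph Q
    using assms(1) by (simp add: acyclic_quiver_def)
  define m where "m = Max (h ` pverts Q)"
  have le: "h a \<le> m" if "a \<in> pverts Q" for a
    using that by (simp add: m_def)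
  have "m \<in> h ` pverts Q"
    unfolding m_def using assms(3) by (intro Max_in) auto
  then obtain d where d: "d \<in> {a \<in> pverts Q. h a = m}"
    by auto
  \<comment> \<open>Well-foundedness yields a vertex \<open>k\<close> of maximal potential with no
    arc entering it from another such vertex. An arc from a lower vertex is impossible, since
    \<open>h\<close> never increases along an arc of \<open>Q\<close>.\<close>
  have "wf (parcs Q)"
    using assms(1) by (intro finite_acyclic_wf) (auto simp: acyclic_quiver_def)
  from wfE_min[OF this d] obtain k where k: "k \<in> pverts Q" "h k = m"
    and min: "\<And>b. (b, k) \<in> parcs Q \<Longrightarrow> \<not> (b \<in> pverts Q \<and> h b = m)"
    by auto
  have False if "(b, k) \<in> parcs Q" for b
  proof -
    have "b \<in> pverts Q"
      using that by (rule in_arcsD1)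
    moreover have "h b = h k \<or> h b = h k + 1"
      using assms(2) that by (auto simp: flip_potential_def)
    ultimately show False
      using min[OF that] le[of b] k(2) by auto
  qed
  with k(1) have "is_source Q k"
    by (auto simp: is_source_iff)
  with that show thesis
    using le[OF assms(3)] k(2) by simp
qed

lemma exists_sink_at_min:
  assumes "acyclic_quiver Q" and "flip_potential h Q Q'" and "c \<in> pverts Q"
  obtains k where "is_sink Q k" and "h k \<le> h c"
proof -
  interpret pair_digraph Q
    using assms(1) by (simp add: acyclic_quiver_def)
  define m where "m = Min (h ` pverts Q)"
  have le: "m \<le> h a" if "a \<in> pverts Q" for a
    using that by (simp add: m_def)
  have "m \<in> h ` pverts Q"
    unfolding m_def using assms(3) by (intro Min_in) auto
  then obtain d where d: "d \<in> {a \<in> pverts Q. h a = m}"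
    by auto
  \<comment> \<open>Dually, the converse relation is used, so that no arc leaves \<open>k\<close>
    towards another vertex of minimal potential.\<close>
  have "wf ((parcs Q)\<inverse>)"
    using assms(1) by (intro finite_acyclic_wf_converse) (auto simp: acyclic_quiver_def)
  from wfE_min[OF this d] obtain k where k: "k \<in> pverts Q" "h k = m"
    and min: "\<And>b. (k, b) \<in> parcs Q \<Longrightarrow> \<not> (b \<in> pverts Q \<and> h b = m)"
    by auto
  have False if "(k, b) \<in> parcs Q" for b
  proof -
    have "b \<in> pverts Q"
      using that by (rule in_arcsD2)
    moreover have "h k = h b \<or> h k = h b + 1"
      using assms(2) that by (auto simp: flip_potential_def)
    ultimately show False
      using min[OF that] le[of b] k(2) by auto
  qed
  with k(1) have "is_sink Q k"
    by (auto simp: is_sink_iff)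
  with that show thesis
    using le[OF assms(3)] k(2) by simp
qed

section \<open>Realising a potential by flips\<close>

definition flip_step_on :: "'a set \<Rightarrow> 'a pair_pre_digraph \<Rightarrow> 'a pair_pre_digraph \<Rightarrow> bool" where
  "flip_step_on A Q Q' \<longleftrightarrow> (\<exists>k\<in>A. (is_source Q k \<or> is_sink Q k) \<and> Q' = flip k Q)"

lemma flip_sequence_if_flip_steps_on:
  assumes "(flip_step_on A)\<^sup>*\<^sup>* Q Q'"
  obtains n P k where "flip_sequence n P k Q Q'" and "\<forall>i<n. k i \<in> A"
proof -
  obtain n where "(flip_step_on A ^^ n) Q Q'"
    using assms by (auto simp: rtranclp_power)
  then obtain P where P: "P 0 = Q" "P n = Q'" "\<forall>i<n. flip_step_on A (P i) (P (Suc i))"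
    by (auto simp: relpowp_fun_conv)
  \<comment> \<open>The bound \<open>i < n\<close> stands under the existential so that choice gives
    a total function \<open>k\<close>, arbitrary from \<open>n\<close> on.\<close>
  then have "\<forall>i. \<exists>x. i < n \<longrightarrow> x \<in> A \<and>
      (is_source (P i) x \<or> is_sink (P i) x) \<and> P (Suc i) = flip x (P i)"
    by (auto simp: flip_step_on_def)
  then obtain k where "\<forall>i<n. k i \<in> A \<and>
      (is_source (P i) (k i) \<or> is_sink (P i) (k i)) \<and> P (Suc i) = flip (k i) (P i)"
    by metis
  with P(1,2) show thesis
    by (intro that[of n P k]) (simp_all add: flip_sequence_def)
qed

lemma flip_steps_on_support:
  assumes "acyclic_quiver Q" and "flip_potential h Q Q'" and "{a \<in> pverts Q. h a \<noteq> 0} \<subseteq> A"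
  shows "(flip_step_on A)\<^sup>*\<^sup>* Q Q'"
  using assms
proof (induction "\<Sum>a\<in>pverts Q. nat \<bar>h a\<bar>" arbitrary: Q h rule: less_induct)
  case less
  interpret pair_digraph Q
    using less.prems(1) by (simp add: acyclic_quiver_def)
  show ?case
  proof (cases "\<forall>a\<in>pverts Q. h a = 0")
    case True
    then have "Q' = Q"
      using less.prems(2) pair_wf_digraph_axioms flip_potential_zero by blast
    then show ?thesis
      by simp
  next
    case False
    then obtain c where c: "c \<in> pverts Q" "h c \<noteq> 0"
      by auto
    \<comment> \<open>The sign \<epsilon> is 1 for a source and -1 for a sink. The strict decrease
      also forces \<open>h k \<noteq> 0\<close>, hence \<open>k \<in> A\<close>.\<close>
    obtain k \<epsilon> where k: "is_source Q k \<or> is_sink Q k"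
      and pot: "flip_potential (\<lambda>a. if a = k then \<epsilon> else 0) Q (flip k Q)"
      and decr: "\<bar>h k - \<epsilon>\<bar> < \<bar>h k\<bar>"
    proof (cases "h c > 0")
      case True
      obtain k where "is_source Q k" "h c \<le> h k"
        using exists_source_at_max[OF less.prems(1,2) c(1)] .
      with True show thesis
        by (intro that[of k 1] flip_potential_flip_source) auto
    next
      case False
      obtain k where "is_sink Q k" "h k \<le> h c"
        using exists_sink_at_min[OF less.prems(1,2) c(1)] .
      with False c(2) show thesis
        by (intro that[of k "- 1"] flip_potential_flip_sink) auto
    qed
    \<comment> \<open>The potential that remains to be realised from \<open>flip k Q\<close> to
      \<open>Q'\<close>: first undo the flip, then apply \<open>h\<close>. It differs from
      \<open>h\<close> only at \<open>k\<close>, so its support stays in \<open>A\<close>.\<close>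
    define g where "g a = - (if a = k then \<epsilon> else 0) + h a" for a
    have kV: "k \<in> pverts Q"
      using k by (auto simp: is_source_iff is_sink_iff)
    have "(\<Sum>a\<in>pverts (flip k Q). nat \<bar>g a\<bar>) < (\<Sum>a\<in>pverts Q. nat \<bar>h a\<bar>)"
      unfolding pverts_flip using kV decr by (intro sum_strict_mono_ex1) (auto simp: g_def)
    moreover have "flip_potential g (flip k Q) Q'"
      unfolding g_def using flip_potential_trans[OF flip_potential_sym[OF pot] less.prems(2)] .
    moreover have "{a \<in> pverts (flip k Q). g a \<noteq> 0} \<subseteq> A"
      using less.prems(3) kV decr by (auto simp: g_def split: if_splits)
    ultimately have "(flip_step_on A)\<^sup>*\<^sup>* (flip k Q) Q'"
      using less.hyps acyclic_quiver_flip[OF less.prems(1) k] by blast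
    moreover have "flip_step_on A Q (flip k Q)"
      using k kV decr less.prems(3) by (auto simp: flip_step_on_def)
    ultimately show ?thesis
      by (rule converse_rtranclp_into_rtranclp[rotated])
  qed
qed

theorem theorem1p9:
  fixes Q Q1 Q2 :: "'a pair_pre_digraph" and v :: 'a
  assumes "acyclic_quiver Q"
    and "v \<in> pverts Q"
    and "Q1 \<in> flip_class_source Q v"
    and "Q2 \<in> flip_class_source Q v"
  shows "\<exists>n P k. flip_sequence n P k Q1 Q2 \<and>
           (\<forall>i\<le>n. is_source (P i) v) \<and>
           (\<forall>i<n. k i \<noteq> v \<and> k i \<notin> neighbors Q v)"
proof -
  have Q1: "acyclic_quiver Q1" "flip_equivalent Q Q1" "is_source Q1 v"
    and Q2: "flip_equivalent Q Q2" "is_source Q2 v"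
    using assms(3,4) by (auto simp: flip_class_source_def flip_class_def)
  obtain h1 where h1: "flip_potential h1 Q Q1"
    using Q1(2) by (rule flip_equivalent_imp_potential)
  obtain h2 where h2: "flip_potential h2 Q Q2"
    using Q2(1) by (rule flip_equivalent_imp_potential)
  \<comment> \<open>The composite potential from \<open>Q1\<close> through \<open>Q\<close> to
    \<open>Q2\<close> is shifted by its own value at \<open>v\<close>.\<close>
  obtain h where h: "flip_potential h Q1 Q2" and hv: "h v = 0"
    using flip_potential_shift[OF flip_potential_trans[OF flip_potential_sym[OF h1] h2],
        of "- h1 v + h2 v"] by auto
  have nb: "neighbors Q v = neighbors Q1 v"
    using neighbors_flip_potential[OF h1] by simp
  \<comment> \<open>An arc from \<open>v\<close> to \<open>w\<close> has the same direction in
    \<open>Q1\<close> and \<open>Q2\<close>, as \<open>v\<close> is a source of both; so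
    \<open>h w = h v\<close>.\<close>
  have "h w = 0" if w: "w \<in> neighbors Q1 v" for w
  proof (cases "w = v")
    case False
    then have "(v, w) \<in> parcs Q1" and "(w, v) \<notin> parcs Q2"
      using w Q1(3) Q2(2) by (auto simp: neighbors_def is_source_iff)
    then show ?thesis
      using h hv unfolding flip_potential_def by metis
  qed (simp add: hv)
  then have "{a \<in> pverts Q1. h a \<noteq> 0} \<subseteq> - insert v (neighbors Q v)"
    using hv nb by auto
  from flip_steps_on_support[OF Q1(1) h this]
  obtain n P k where seq: "flip_sequence n P k Q1 Q2"
    and k: "\<forall>i<n. k i \<in> - insert v (neighbors Q v)"
    by (rule flip_sequence_if_flip_steps_on)
  \<comment> \<open>The invariant includes the neighbors because \<open>is_source_flip\<close> needs
    \<open>k i\<close> to be no neighbor of \<open>v\<close> in the current quiver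
    \<open>P i\<close>, whereas \<open>k\<close> is controlled relative to \<open>Q\<close>.\<close>
  have "is_source (P i) v \<and> neighbors (P i) v = neighbors Q v" if "i \<le> n" for i
    using that
  proof (induction i)
    case 0
    then show ?case
      using seq Q1(3) nb by (simp add: flip_sequence_def)
  next
    case (Suc i)
    then have "P (Suc i) = flip (k i) (P i)"
      using seq by (simp add: flip_sequence_def)
    with Suc k show ?case
      by (simp add: is_source_flip)
  qed
  with seq k show ?thesis
    by blast
qed

end
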